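(* Let $a_1,\ldots,a_n$ be nonnegative integers and let $r,s,t,u,v$ be distinct integers in $\{1,2,\dots,n\}$. Then the following three identities hold: $$\mathrm{CT}_{\mathbf{x}}\ \frac{(x_s-x_t)(x_u-x_v)}{x_r^2}D_n(\mathbf{x},\mathbf{a})=0,$$ $$\mathrm{CT}_{\mathbf{x}}\ \frac{(x_s-x_u)(x_s-x_v)}{x_r^2}D_n(\mathbf{x},\mathbf{a})=-\frac{a_r(a+1)}{(2+a^{(r)})(1+a^{(r)}-a_s)}C_n(\mathbf{a}),$$ $$\mathrm{CT}_{\mathbf{x}}\ \frac{(x_s-x_t)^2}{x_r^2}D_n(\mathbf{x},\mathbf{a})=-\frac{a_r(a+1)}{2+a^{(r)}}\left(\frac{1}{1+a^{(r)}-a_s}+\frac{1}{1+a^{(r)}-a_t}\right)C_n(\mathbf{a}).$$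
   Context: For nonnegative integers $a_1,\ldots,a_n$, write $\mathbf{a}=(a_1,\ldots,a_n)$ and $\mathbf{x}=(x_1,\ldots,x_n)$ (indeterminates). The Dyson product is the Laurent polynomial $D_n(\mathbf{x},\mathbf{a}):=\prod_{1\le i\ne j\le n}\left(1-\frac{x_i}{x_j}\right)^{a_i}$ (product over all ordered pairs $(i,j)$ with $i\neq j$). $\mathrm{CT}_{\mathbf{x}}f(\mathbf{x})$ denotes the constant term of the Laurent polynomial $f$ in the variables $x_1,\ldots,x_n$, i.e. the coefficient of $x_1^0\cdots x_n^0$. Set $a:=a_1+a_2+\cdots+a_n$, $a^{(j)}:=a-a_j$, and $C_n(\mathbf{a}):=\frac{(a_1+a_2+\cdots+a_n)!}{a_1!\,a_2!\cdots a_n!}$. *)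

theory Defs
  imports Complex_Main "HOL-Library.Poly_Mapping"
begin

text \<open>
  Laurent polynomials over the rationals in indeterminates indexed by the natural numbers:
  finitely supported coefficient functions on finitely supported integer exponent vectors,
  multiplied by convolution. Expressions in the first \<open>n\<close> indeterminates
  \<open>x\<^sub>1, \<dots>, x\<^sub>n\<close> form a subring, and for these the coefficient at exponent vector 0
  is the constant term in \<open>x\<^sub>1, \<dots>, x\<^sub>n\<close>.
\<close>

type_synonym laurent = "(nat \<Rightarrow>\<^sub>0 int) \<Rightarrow>\<^sub>0 rat"

text \<open>\<open>X_pow i k\<close> is the monomial \<open>x\<^sub>i\<close> raised to the integer power \<open>k\<close>; division by
  a power of \<open>x\<^sub>i\<close> is multiplication by the corresponding negative power.\<close>

definition X_pow :: "nat \<Rightarrow> int \<Rightarrow> laurent" where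
  "X_pow i k = Poly_Mapping.single (Poly_Mapping.single i k) 1"

abbreviation X :: "nat \<Rightarrow> laurent" where
  "X i \<equiv> X_pow i 1"

definition CT :: "laurent \<Rightarrow> rat" where
  "CT f = Poly_Mapping.lookup f 0"

definition dyson_product :: "nat \<Rightarrow> (nat \<Rightarrow> nat) \<Rightarrow> laurent" where
  "dyson_product n a =
     (\<Prod>(i, j) \<in> {(i, j). i \<in> {1..n} \<and> j \<in> {1..n} \<and> i \<noteq> j}. (1 - X i * X_pow j (- 1)) ^ a i)"

definition a_sum :: "nat \<Rightarrow> (nat \<Rightarrow> nat) \<Rightarrow> nat" where
  "a_sum n a = (\<Sum>i = 1..n. a i)"

text \<open>The number written \<open>a\<close> with superscript \<open>(j)\<close>; rational-valued so that no subtraction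
  is truncated.\<close>

definition a_sum_without :: "nat \<Rightarrow> (nat \<Rightarrow> nat) \<Rightarrow> nat \<Rightarrow> rat" where
  "a_sum_without n a j = of_nat (a_sum n a) - of_nat (a j)"

definition dyson_const :: "nat \<Rightarrow> (nat \<Rightarrow> nat) \<Rightarrow> rat" where
  "dyson_const n a = fact (a_sum n a) / (\<Prod>i = 1..n. fact (a i))"

end

theory Submission
  imports Defs "HOL-Computational_Algebra.Polynomial"
begin

text \<open>
  The expansions of the three numerators only involve the constant terms of
  \<open>x\<^sub>s x\<^sub>t / x\<^sub>r\<^sup>2\<close> times the Dyson product, so the theorem follows from one closed
  formula for these (\<open>CT_dyson_quadratic\<close>), valid for \<open>s \<noteq> t\<close> and for \<open>s = t\<close>. Write
  \<open>m\<close> for the sum of the \<open>a\<^sub>i\<close> with \<open>i \<noteq> r\<close>, \<open>h\<^sub>i = a\<^sub>i / (1 + m - a\<^sub>i)\<close>, and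
  \<open>\<delta>\<close> for 1 if \<open>s = t\<close> and 0 otherwise. Then the constant term is
  \<open>a\<^sub>r / ((1 + m) (2 + m)) * (2 a\<^sub>r + m + (1 + a\<^sub>r + m) Y)\<close> times the multinomial coefficient,
  where \<open>Y = - \<delta> - \<Sum> h\<^sub>i\<close>, the sum extending over \<open>i\<close> outside \<open>{r, s, t}\<close>.
  Equivalently \<open>Y = h\<^sub>s + h\<^sub>t - H - \<delta> (1 + h\<^sub>s)\<close> with \<open>H\<close> the sum over all
  \<open>i \<noteq> r\<close>. Apart from the diagonal contribution this is a function of \<open>s\<close> plus a function of
  \<open>t\<close>, so the alternating combinations in the theorem annihilate it; the diagonal leaves the terms \<open>1 + h\<^sub>s = (1 + m) / (1 + m - a\<^sub>s)\<close>.

  The closed formula is proved by Good's method. Lagrange interpolation of the constant 1 shows that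
  the Dyson product with positive exponents is the sum of the Dyson products in which one exponent
  is lowered by 1 (\<open>dyson_recursion\<close>). This recursion and the values at exponent vectors with
  some \<open>a\<^sub>k = 0\<close> determine every constant term. If \<open>a\<^sub>k = 0\<close>, the variable \<open>x\<^sub>k\<close>
  occurs in the Dyson product only through \<open>\<Prod>\<^sub>i (1 - x\<^sub>i / x\<^sub>k) ^ a\<^sub>i\<close>, and extracting the
  coefficient of \<open>1 / x\<^sub>k\<close> or \<open>1 / x\<^sub>k\<^sup>2\<close> expresses the constant term by constant terms
  in one variable less (\<open>CT_dyson_remove\<close>). These are again quadratic, or linear
  (\<open>CT_dyson_linear\<close>), or Dyson's original constant term (\<open>CT_dyson\<close>), according to how many
  copies of \<open>x\<^sub>r\<close> are cancelled.

  It remains to see that the closed form has the same boundary values and satisfies the recursion.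
  For the latter, the multinomial coefficient at a lowered vector is \<open>a\<^sub>k / a\<close> times the original,
  so the prefactor has to be its own weighted average (\<open>CT_dyson_step\<close>). The decisive fact is
  that each \<open>h\<^sub>i\<close>, and hence \<open>Y\<close>, is its own average over the indices other than \<open>r\<close>
  (\<open>ratio_step\<close>), after which \<open>Y\<close> can be treated as a constant.
\<close>

section \<open>Exponents of a single variable\<close>

text \<open>
  The exponents of one chosen variable that occur in a Laurent polynomial are confined to a set.
  Two uses: a polynomial in which the variable has only nonzero exponents has constant term 0, and
  the set \<open>{0}\<close> says that the variable does not occur.
\<close>

definition exps_in :: "nat \<Rightarrow> int set \<Rightarrow> laurent \<Rightarrow> bool" where
  "exps_in k E f \<longleftrightarrow> (\<forall>m \<in> Poly_Mapping.keys f. Poly_Mapping.lookup m k \<in> E)"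

lemma exps_in_mono: "exps_in k E f \<Longrightarrow> E \<subseteq> F \<Longrightarrow> exps_in k F f"
  by (auto simp: exps_in_def)

lemma exps_in_add:
  assumes "exps_in k E f" "exps_in k E g" shows "exps_in k E (f + g)"
  using assms keys_add[of f g] by (fastforce simp: exps_in_def)

lemma exps_in_minus: "exps_in k E f \<Longrightarrow> exps_in k E (- f)"
  by (simp add: exps_in_def)

lemma exps_in_diff:
  assumes "exps_in k E f" "exps_in k E g" shows "exps_in k E (f - g)"
  using exps_in_add[OF assms(1) exps_in_minus[OF assms(2)]] by simp

lemma exps_in_mult:
  assumes "exps_in k E f" "exps_in k F g" "\<And>x y. x \<in> E \<Longrightarrow> y \<in> F \<Longrightarrow> x + y \<in> G"
  shows "exps_in k G (f * g)"
  unfolding exps_in_def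
proof
  fix m assume "m \<in> Poly_Mapping.keys (f * g)"
  then obtain p q where "p \<in> Poly_Mapping.keys f" "q \<in> Poly_Mapping.keys g" "m = p + q"
    using keys_mult[of f g] by blast
  then show "Poly_Mapping.lookup m k \<in> G"
    using assms by (auto simp: exps_in_def lookup_add)
qed

lemma exps_in_0: "exps_in k E 0"
  by (simp add: exps_in_def)

lemma exps_in_1: "0 \<in> E \<Longrightarrow> exps_in k E 1"
  by (simp add: exps_in_def flip: single_one)

lemma exps_in_X_pow: "(if i = k then d else 0) \<in> E \<Longrightarrow> exps_in k E (X_pow i d)"
  by (auto simp: exps_in_def X_pow_def lookup_single when_def)

lemma exps_in_prod:
  assumes "\<And>i. i \<in> I \<Longrightarrow> exps_in k E (f i)" "0 \<in> E" "\<And>x y. x \<in> E \<Longrightarrow> y \<in> E \<Longrightarrow> x + y \<in> E"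
  shows "exps_in k E (\<Prod>i\<in>I. f i)"
  using assms by (induction I rule: infinite_finite_induct) (auto intro: exps_in_1 exps_in_mult)

lemma exps_in_power:
  assumes "exps_in k E f" "0 \<in> E" "\<And>x y. x \<in> E \<Longrightarrow> y \<in> E \<Longrightarrow> x + y \<in> E"
  shows "exps_in k E (f ^ n)"
  using exps_in_prod[of "{..<n}" k E "\<lambda>_. f"] assms by simp

lemma CT_eq_0: "exps_in k E f \<Longrightarrow> 0 \<notin> E \<Longrightarrow> CT f = 0"
  by (auto simp: exps_in_def CT_def in_keys_iff dest!: bspec[where x = 0])

lemma CT_0 [simp]: "CT 0 = 0" and CT_1 [simp]: "CT 1 = 1"
  and CT_add: "CT (f + g) = CT f + CT g" and CT_diff: "CT (f - g) = CT f - CT g"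
  by (simp_all add: CT_def lookup_add lookup_minus)

lemma CT_sum: "CT (\<Sum>i\<in>I. f i) = (\<Sum>i\<in>I. CT (f i))"
  by (simp add: CT_def lookup_sum)

lemma CT_of_nat_mult: "CT (of_nat n * f) = of_nat n * CT f"
  by (induction n) (simp_all add: CT_add algebra_simps)

lemma X_pow_add: "X_pow i d * X_pow i e = X_pow i (d + e)"
  by (simp add: X_pow_def mult_single single_add)

lemma X_pow_0 [simp]: "X_pow i 0 = 1"
  by (simp add: X_pow_def flip: single_one)

lemma X_inj: "X i = X j \<longleftrightarrow> i = j"
proof
  assume "X i = X j"
  then have "Poly_Mapping.lookup (X i) (Poly_Mapping.single i 1) =
     Poly_Mapping.lookup (X j) (Poly_Mapping.single i 1)" by simp
  then have "Poly_Mapping.single j (1::int) = Poly_Mapping.single i 1"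
    by (auto simp: X_pow_def lookup_single when_def split: if_splits)
  then have "Poly_Mapping.lookup (Poly_Mapping.single j (1::int)) i = 1" by simp
  then show "i = j" by (auto simp: lookup_single when_def split: if_splits)
qed auto

section \<open>The Dyson product and its recursion\<close>

text \<open>
  The Dyson product is indexed here by an arbitrary finite set of variables, because the induction
  deletes variables one at a time. Grouping the factors by their numerator variable gives
  \<open>\<Prod>\<^sub>i p\<^sub>i ^ a\<^sub>i\<close>, the form in which lowering a single exponent is visible.
\<close>

definition dyson_factor :: "nat set \<Rightarrow> nat \<Rightarrow> laurent" where
  "dyson_factor S i = (\<Prod>j\<in>S - {i}. 1 - X i * X_pow j (- 1))"

definition dyson :: "nat set \<Rightarrow> (nat \<Rightarrow> nat) \<Rightarrow> laurent" where
  "dyson S a = (\<Prod>i\<in>S. dyson_factor S i ^ a i)"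

lemma dyson_product_eq: "dyson_product n a = dyson {1..n} a"
proof -
  have "{(i, j). i \<in> {1..n} \<and> j \<in> {1..n} \<and> i \<noteq> j} = (SIGMA i:{1..n}. {1..n} - {i})"
    by auto
  then show ?thesis
    by (simp add: dyson_product_def dyson_def dyson_factor_def prod.Sigma prod_power_distrib)
qed

text \<open>
  Lagrange interpolation of the constant 1 at the nodes \<open>x\<^sub>k\<close>, evaluated at 0 and cleared of
  denominators. The difference \<open>P\<close> of the two sides, with 0 replaced by an indeterminate, has
  degree below \<open>card S\<close> and vanishes at all \<open>card S\<close> nodes. Clearing denominators lets the
  argument run in any integral domain, in particular in the ring of Laurent polynomials.
\<close>

lemma interpolation_identity:
  fixes x :: "'b \<Rightarrow> 'a::idom"
  assumes "finite S" "S \<noteq> {}" "inj_on x S"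
  defines "q \<equiv> \<lambda>i. \<Prod>j\<in>S - {i}. x j - x i"
  shows "(\<Prod>i\<in>S. q i) = (\<Sum>k\<in>S. (\<Prod>j\<in>S - {k}. x j) * (\<Prod>i\<in>S - {k}. q i))"
proof -
  define P where "P = [:\<Prod>i\<in>S. q i:] -
    (\<Sum>k\<in>S. smult (\<Prod>i\<in>S - {k}. q i) (\<Prod>j\<in>S - {k}. [:x j, - 1:]))"
  have deg: "degree (\<Prod>j\<in>S - {k}. [:x j, - 1:]) \<le> card S - 1" if "k \<in> S" for k
  proof -
    have "degree (\<Prod>j\<in>S - {k}. [:x j, - 1:]) \<le> (\<Sum>j\<in>S - {k}. degree [:x j, - 1:])"
      using assms by (intro degree_prod_sum_le[unfolded o_def]) auto
    also have "\<dots> = card S - 1" using assms that by simp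
    finally show ?thesis .
  qed
  have "degree P \<le> card S - 1"
    unfolding P_def
    by (intro degree_diff_le degree_sum_le order_trans[OF degree_smult_le] deg assms) auto
  moreover have "poly P y = 0" if "y \<in> x ` S" for y
  proof -
    from that obtain m where m: "m \<in> S" "y = x m" by auto
    have "(\<Prod>i\<in>S - {k}. q i) * (\<Prod>j\<in>S - {k}. x j - x m) = (if k = m then \<Prod>i\<in>S. q i else 0)"
      if "k \<in> S" for k
    proof (cases "k = m")
      case True
      then show ?thesis using m assms(1) by (simp add: q_def prod.remove[of S m] mult.commute)
    next
      case False
      then have "(\<Prod>j\<in>S - {k}. x j - x m) = 0"
        using m assms(1) by (intro prod_zero) auto
      then show ?thesis using False by simp
    qed
    then show ?thesis using m assms(1)
      by (simp add: P_def poly_sum poly_prod)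
  qed
  moreover have "card (x ` S) = card S" using assms by (simp add: card_image)
  moreover have "card S > 0" using assms by (simp add: card_gt_0_iff)
  ultimately have "P = 0"
    by (intro poly_eqI_degree[where A = "x ` S"]) auto
  then have "poly P 0 = 0" by simp
  then show ?thesis by (simp add: P_def poly_sum poly_prod mult.commute)
qed

text \<open>
  This is \<open>\<Sum>\<^sub>k 1 / p\<^sub>k = 1\<close> multiplied by \<open>\<Prod>\<^sub>i p\<^sub>i\<close>. It is
  the interpolation identity up to a unit, since
  \<open>p\<^sub>i = \<Prod>\<^sub>j (x\<^sub>j - x\<^sub>i) / x\<^sub>j\<close>.
\<close>

lemma prod_dyson_factor:
  assumes "finite S" "S \<noteq> {}"
  shows "(\<Prod>i\<in>S. dyson_factor S i) = (\<Sum>k\<in>S. \<Prod>i\<in>S - {k}. dyson_factor S i)"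
proof -
  define q where "q = (\<lambda>i. \<Prod>j\<in>S - {i}. X j - X i)"
  define w where "w = (\<lambda>i. \<Prod>j\<in>S - {i}. X_pow j (- 1))"
  have unit: "X j * X_pow j (- 1) = 1" for j by (simp add: X_pow_add)
  have fac: "dyson_factor S i = q i * w i" for i
    unfolding dyson_factor_def q_def w_def prod.distrib[symmetric]
    by (intro prod.cong) (auto simp: algebra_simps unit)
  have w: "(\<Prod>i\<in>S. w i) * (\<Prod>j\<in>S - {k}. X j) = (\<Prod>i\<in>S - {k}. w i)" if "k \<in> S" for k
  proof -
    have "w k * (\<Prod>j\<in>S - {k}. X j) = 1"
      unfolding w_def prod.distrib[symmetric] by (simp add: mult.commute unit)
    then show ?thesis using assms(1) that by (simp add: prod.remove[of S k] mult_ac)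
  qed
  have "(\<Prod>i\<in>S. dyson_factor S i) = (\<Prod>i\<in>S. w i) * (\<Prod>i\<in>S. q i)"
    by (simp add: fac prod.distrib mult.commute)
  also have "\<dots> = (\<Prod>i\<in>S. w i) * (\<Sum>k\<in>S. (\<Prod>j\<in>S - {k}. X j) * (\<Prod>i\<in>S - {k}. q i))"
    unfolding q_def using assms by (subst interpolation_identity) (auto simp: inj_on_def X_inj)
  also have "\<dots> = (\<Sum>k\<in>S. ((\<Prod>i\<in>S. w i) * (\<Prod>j\<in>S - {k}. X j)) * (\<Prod>i\<in>S - {k}. q i))"
    by (simp add: sum_distrib_left mult.assoc)
  also have "\<dots> = (\<Sum>k\<in>S. \<Prod>i\<in>S - {k}. dyson_factor S i)"
    by (intro sum.cong refl) (simp add: w fac prod.distrib mult.commute)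
  finally show ?thesis .
qed

text \<open>
  Multiplying \<open>prod_dyson_factor\<close> by \<open>\<Prod>\<^sub>i p\<^sub>i ^ (a\<^sub>i - 1)\<close>, which is where
  positivity of every exponent enters.
\<close>

lemma dyson_recursion:
  assumes "finite S" "S \<noteq> {}" "\<And>i. i \<in> S \<Longrightarrow> a i > 0"
  shows "dyson S a = (\<Sum>k\<in>S. dyson S (a(k := a k - 1)))"
proof -
  define B where "B = (\<Prod>i\<in>S. dyson_factor S i ^ (a i - 1))"
  have pw: "dyson_factor S i ^ (a i - Suc 0) * dyson_factor S i = dyson_factor S i ^ a i"
    if "i \<in> S" for i
    using assms(3)[OF that] by (cases "a i") auto
  have "dyson S a = B * (\<Prod>i\<in>S. dyson_factor S i)"
    by (simp add: dyson_def B_def pw flip: prod.distrib)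
  also have "\<dots> = (\<Sum>k\<in>S. B * (\<Prod>i\<in>S - {k}. dyson_factor S i))"
    using assms by (simp add: prod_dyson_factor sum_distrib_left)
  also have "\<dots> = (\<Sum>k\<in>S. dyson S (a(k := a k - 1)))"
  proof (intro sum.cong refl)
    fix k assume "k \<in> S"
    then show "B * (\<Prod>i\<in>S - {k}. dyson_factor S i) = dyson S (a(k := a k - 1))"
      using assms(1)
      by (simp add: B_def dyson_def prod.remove[of S k] mult.assoc pw flip: prod.distrib)
  qed
  finally show ?thesis .
qed

text \<open>
  If \<open>a\<^sub>k = 0\<close>, then \<open>x\<^sub>k\<close> is never a numerator, so all of its occurrences are
  collected in the second factor, a polynomial in \<open>1 / x\<^sub>k\<close>.
\<close>

lemma dyson_remove:
  assumes "finite S" "k \<in> S" "a k = 0"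
  shows "dyson S a = dyson (S - {k}) a * (\<Prod>i\<in>S - {k}. (1 - X i * X_pow k (- 1)) ^ a i)"
proof -
  have "dyson_factor S i = dyson_factor (S - {k}) i * (1 - X i * X_pow k (- 1))"
    if "i \<in> S - {k}" for i
  proof -
    have "S - {i} = insert k (S - {k} - {i})" using that assms by auto
    then show ?thesis using assms(1) by (simp add: dyson_factor_def mult.commute)
  qed
  then have "(\<Prod>i\<in>S - {k}. dyson_factor S i ^ a i) =
      (\<Prod>i\<in>S - {k}. (dyson_factor (S - {k}) i * (1 - X i * X_pow k (- 1))) ^ a i)"
    by (intro prod.cong) auto
  then show ?thesis using assms
    by (simp add: dyson_def prod.remove[of S k] power_mult_distrib prod.distrib)
qed

lemma exps_in_dyson:
  assumes "k \<notin> S"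
  shows "exps_in k {0} (dyson S a)"
  unfolding dyson_def dyson_factor_def using assms
  by (intro exps_in_prod exps_in_power exps_in_diff exps_in_1
      exps_in_mult[where E = "{0}" and F = "{0}"] exps_in_X_pow) auto

section \<open>Eliminating a variable with exponent zero\<close>

text \<open>
  With \<open>w = 1 / x\<^sub>k\<close>, the expansion of \<open>F = \<Prod>\<^sub>y (1 - y w)\<close> modulo
  \<open>w\<^sup>3\<close>, expressed by the power sums \<open>e = \<Sum> y\<close> and \<open>p = \<Sum> y\<^sup>2\<close>. The
  coefficient of \<open>w\<^sup>2\<close> is the second elementary symmetric polynomial
  \<open>(e\<^sup>2 - p) / 2\<close>; doubling \<open>F\<close> avoids the division. Power sums are used because they
  are additive under multiplication of \<open>F\<close> by further factors.
\<close>

definition truncation :: "nat \<Rightarrow> laurent \<Rightarrow> laurent \<Rightarrow> laurent \<Rightarrow> bool" where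
  "truncation k e p F \<longleftrightarrow> exps_in k {0} e \<and> exps_in k {0} p \<and>
     (\<exists>R. exps_in k {..0} R \<and>
       2 * F = 2 - 2 * e * X_pow k (- 1) + (e\<^sup>2 - p) * X_pow k (- 2) + X_pow k (- 3) * R)"

lemma truncation_mult:
  assumes "truncation k e p F" "exps_in k {0} y"
  shows "truncation k (e + y) (p + y\<^sup>2) (F * (1 - y * X_pow k (- 1)))"
proof -
  let ?w = "X_pow k (- 1)"
  from assms obtain R where R: "exps_in k {..0} R"
    and F: "2 * F = 2 - 2 * e * ?w + (e\<^sup>2 - p) * X_pow k (- 2) + X_pow k (- 3) * R"
    and ep: "exps_in k {0} e" "exps_in k {0} p"
    by (auto simp: truncation_def)
  have w: "X_pow k (- 2) = ?w * ?w" "X_pow k (- 3) = ?w * ?w * ?w" by (simp_all add: X_pow_add)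
  have "2 * (F * (1 - y * ?w)) = (2 * F) * (1 - y * ?w)" by (simp add: mult_ac)
  also have "\<dots> = 2 - 2 * (e + y) * ?w + ((e + y)\<^sup>2 - (p + y\<^sup>2)) * X_pow k (- 2)
      + X_pow k (- 3) * (R * (1 - y * ?w) - (e\<^sup>2 - p) * y)"
    unfolding F w by (simp add: algebra_simps power2_eq_square)
  finally have eq: "2 * (F * (1 - y * ?w)) = \<dots>" .
  have sq: "exps_in k {0} (z\<^sup>2)" if "exps_in k {0} z" for z
    using that by (intro exps_in_power) auto
  have y: "exps_in k {..0} (1 - y * ?w)"
    by (intro exps_in_diff exps_in_1 exps_in_mult[OF assms(2), where F = "{-1}"] exps_in_X_pow) auto
  have "exps_in k {0} ((e\<^sup>2 - p) * y)"
    by (rule exps_in_mult[where E = "{0}" and F = "{0}"])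
      (use ep assms(2) in \<open>auto intro!: exps_in_diff sq\<close>)
  then have "exps_in k {..0} ((e\<^sup>2 - p) * y)" by (rule exps_in_mono) auto
  then have "exps_in k {..0} (R * (1 - y * ?w) - (e\<^sup>2 - p) * y)"
    by (intro exps_in_diff exps_in_mult[OF R y]) auto
  then show ?thesis
    using eq ep assms(2) sq by (auto simp: truncation_def intro!: exps_in_add)
qed

lemma truncation_power:
  assumes "truncation k e p F" "exps_in k {0} y"
  shows "truncation k (e + of_nat n * y) (p + of_nat n * y\<^sup>2) (F * (1 - y * X_pow k (- 1)) ^ n)"
proof (induction n)
  case (Suc n)
  from truncation_mult[OF Suc assms(2)] show ?case by (simp add: algebra_simps)
qed (use assms in simp)

lemma truncation_prod:
  assumes "finite T" "k \<notin> T"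
  shows "truncation k (\<Sum>i\<in>T. of_nat (a i) * X i) (\<Sum>i\<in>T. of_nat (a i) * (X i)\<^sup>2)
    (\<Prod>i\<in>T. (1 - X i * X_pow k (- 1)) ^ a i)"
  using assms
proof (induction T rule: finite_induct)
  case empty
  show ?case by (auto simp: truncation_def exps_in_0 intro!: exI[of _ 0])
next
  case (insert i T)
  have "exps_in k {0} (X i)" using insert by (intro exps_in_X_pow) auto
  from truncation_power[OF insert.IH this, of "a i"] insert show ?case
    by (simp add: add.commute mult.commute)
qed

lemma CT_2: "CT (2 * f) = 2 * CT f"
  using CT_of_nat_mult[of 2 f] by simp

text \<open>
  Only the term of the expansion whose power of \<open>1 / x\<^sub>k\<close> cancels the given power of
  \<open>x\<^sub>k\<close> survives; the remainder contributes negative powers of \<open>x\<^sub>k\<close> only.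
\<close>

lemma CT_truncation:
  assumes F: "truncation k e p F" and g: "exps_in k {0} g"
  shows "CT (g * F) = CT g" "CT (g * X k * F) = - CT (g * e)"
    "2 * CT (g * (X k)\<^sup>2 * F) = CT (g * e\<^sup>2) - CT (g * p)"
proof -
  from F obtain R where R: "exps_in k {..0} R"
    and eq: "2 * F = 2 - 2 * e * X_pow k (- 1) + (e\<^sup>2 - p) * X_pow k (- 2) + X_pow k (- 3) * R"
    and ep: "exps_in k {0} e" "exps_in k {0} p"
    by (auto simp: truncation_def)
  have mon: "CT (h * X_pow k d) = 0" if "exps_in k {0} h" "d \<noteq> 0" for h d
    by (rule CT_eq_0[where k = k and E = "{d}"])
      (use that in \<open>auto intro!: exps_in_mult[OF that(1), where F = "{d}"] exps_in_X_pow\<close>)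
  \<comment> \<open>The hypothesis \<open>d < 0\<close> is met for numerators up to \<open>x\<^sub>k\<^sup>2\<close>, which is why the expansion stops at the third power.\<close>
  have rest: "CT (h * X_pow k d * R) = 0" if "exps_in k {0} h" "d < 0" for h d
    by (rule CT_eq_0[where k = k and E = "{..<0}"])
      (use that in \<open>auto intro!: exps_in_mult[OF _ R, where E = "{d}"]
          exps_in_mult[OF that(1), where F = "{d}"] exps_in_X_pow\<close>)
  have ge: "exps_in k {0} (g * e)" "exps_in k {0} (g * (e\<^sup>2 - p))"
    using g ep by (auto intro!: exps_in_mult[OF g, where F = "{0}"] exps_in_diff exps_in_power)
  have gen: "2 * CT (g * X_pow k d * F) = 2 * CT (g * X_pow k d) - 2 * CT (g * e * X_pow k (d - 1))
      + CT (g * (e\<^sup>2 - p) * X_pow k (d - 2))" if "d < 3" for d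
  proof -
    have "2 * (g * X_pow k d * F) = g * X_pow k d * (2 * F)" by (simp add: mult_ac)
    also have "\<dots> = 2 * (g * X_pow k d) - 2 * (g * e * (X_pow k d * X_pow k (- 1)))
        + g * (e\<^sup>2 - p) * (X_pow k d * X_pow k (- 2)) + g * (X_pow k d * X_pow k (- 3)) * R"
      unfolding eq by (simp add: algebra_simps)
    finally have "2 * (g * X_pow k d * F) = 2 * (g * X_pow k d) - 2 * (g * e * X_pow k (d - 1))
        + g * (e\<^sup>2 - p) * X_pow k (d - 2) + g * X_pow k (d - 3) * R"
      by (simp add: X_pow_add)
    from arg_cong[OF this, of CT] show ?thesis
      using rest[OF g, of "d - 3"] that by (simp add: CT_add CT_diff CT_2)
  qed
  show "CT (g * F) = CT g" using gen[of 0] mon[OF ge(1)] mon[OF ge(2)] by simp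
  show "CT (g * X k * F) = - CT (g * e)" using gen[of 1] mon[OF g] mon[OF ge(2)] by simp
  have "(X k)\<^sup>2 = X_pow k 2" by (simp add: power2_eq_square X_pow_add)
  then show "2 * CT (g * (X k)\<^sup>2 * F) = CT (g * e\<^sup>2) - CT (g * p)"
    using gen[of 2] mon[OF g] mon[OF ge(1)] by (simp add: algebra_simps CT_diff)
qed

text \<open>
  Elimination of a variable with \<open>a\<^sub>k = 0\<close> from a constant term: the power
  \<open>x\<^sub>k ^ d\<close> is replaced by the coefficient of \<open>x\<^sub>k ^ (-d)\<close> in the Dyson product.
\<close>

lemma CT_dyson_remove:
  assumes S: "finite S" "k \<in> S" "a k = 0" and M: "exps_in k {0} M"
  defines "T \<equiv> S - {k}"
  shows "CT (M * dyson S a) = CT (M * dyson T a)"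
    "CT (X k * M * dyson S a) = - (\<Sum>i\<in>T. of_nat (a i) * CT (X i * M * dyson T a))"
    "2 * CT ((X k)\<^sup>2 * M * dyson S a) =
      (\<Sum>i\<in>T. \<Sum>j\<in>T. of_nat (a i) * of_nat (a j) * CT (X i * X j * M * dyson T a))
      - (\<Sum>i\<in>T. of_nat (a i) * CT (X i * X i * M * dyson T a))"
proof -
  define F where "F = (\<Prod>i\<in>T. (1 - X i * X_pow k (- 1)) ^ a i)"
  have F: "truncation k (\<Sum>i\<in>T. of_nat (a i) * X i) (\<Sum>i\<in>T. of_nat (a i) * (X i)\<^sup>2) F"
    unfolding F_def using S by (intro truncation_prod) (auto simp: T_def)
  have D: "dyson S a = dyson T a * F" using S by (simp add: dyson_remove F_def T_def)
  have g: "exps_in k {0} (M * dyson T a)"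
    by (rule exps_in_mult[OF M exps_in_dyson]) (auto simp: T_def)
  note ct = CT_truncation[OF F g]
  have scal: "CT (of_nat m * of_nat n * f) = of_nat m * of_nat n * CT f" for m n f
    using CT_of_nat_mult[of "m * n" f] by simp
  show "CT (M * dyson S a) = CT (M * dyson T a)" using ct(1) by (simp add: D mult_ac)
  have "M * dyson T a * (\<Sum>i\<in>T. of_nat (a i) * X i)
      = (\<Sum>i\<in>T. of_nat (a i) * (X i * M * dyson T a))"
    by (simp add: sum_distrib_left mult_ac)
  moreover have "X k * M * dyson S a = M * dyson T a * X k * F"
    by (simp add: D mult_ac)
  ultimately show "CT (X k * M * dyson S a) = - (\<Sum>i\<in>T. of_nat (a i) * CT (X i * M * dyson T a))"
    by (simp only: ct(2) CT_sum CT_of_nat_mult)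
  have "M * dyson T a * (\<Sum>i\<in>T. of_nat (a i) * X i)\<^sup>2
      = (\<Sum>i\<in>T. \<Sum>j\<in>T. of_nat (a i) * of_nat (a j) * (X i * X j * M * dyson T a))"
    by (simp add: power2_eq_square sum_product sum_distrib_left mult_ac)
  moreover have "M * dyson T a * (\<Sum>i\<in>T. of_nat (a i) * (X i)\<^sup>2)
      = (\<Sum>i\<in>T. of_nat (a i) * (X i * X i * M * dyson T a))"
    by (simp add: sum_distrib_left mult_ac power2_eq_square)
  moreover have "(X k)\<^sup>2 * M * dyson S a = M * dyson T a * (X k)\<^sup>2 * F"
    by (simp add: D mult_ac)
  ultimately show "2 * CT ((X k)\<^sup>2 * M * dyson S a) =
      (\<Sum>i\<in>T. \<Sum>j\<in>T. of_nat (a i) * of_nat (a j) * CT (X i * X j * M * dyson T a))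
      - (\<Sum>i\<in>T. of_nat (a i) * CT (X i * X i * M * dyson T a))"
    by (simp only: ct(3) CT_sum CT_of_nat_mult scal)
qed

text \<open>
  With \<open>a\<^sub>r = 0\<close> the Dyson product contains no positive power of \<open>x\<^sub>r\<close>, so nothing
  can compensate the negative power in \<open>M\<close>.
\<close>

lemma CT_dyson_negative_power:
  assumes "finite S" "r \<in> S" "a r = 0" "exps_in r {..<0} M"
  shows "CT (M * dyson S a) = 0"
proof -
  have "exps_in r {..0} (\<Prod>i\<in>S - {r}. (1 - X i * X_pow r (- 1)) ^ a i)"
    by (intro exps_in_prod exps_in_power exps_in_diff exps_in_1
        exps_in_mult[where E = "{0}" and F = "{- 1}"] exps_in_X_pow) auto
  moreover have "exps_in r {..0} (dyson (S - {r}) a)"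
    by (rule exps_in_mono[OF exps_in_dyson]) auto
  ultimately have "exps_in r {..0} (dyson S a)"
    using assms by (auto simp: dyson_remove intro!: exps_in_mult[where E = "{..0}" and F = "{..0}"])
  then have "exps_in r {..<0} (M * dyson S a)"
    by (rule exps_in_mult[OF assms(4)]) auto
  then show ?thesis by (rule CT_eq_0) auto
qed

section \<open>Multinomial coefficients and the induction principle\<close>

definition multinomial :: "nat set \<Rightarrow> (nat \<Rightarrow> nat) \<Rightarrow> rat" where
  "multinomial S a = fact (sum a S) / (\<Prod>i\<in>S. fact (a i))"

lemma multinomial_remove:
  assumes "finite S" "k \<in> S" "a k = 0"
  shows "multinomial (S - {k}) a = multinomial S a"
  using assms by (simp add: multinomial_def sum.remove[of S k] prod.remove[of S k])

text \<open>
  The multinomial coefficient satisfies the same recursion as the Dyson product, each summand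
  being a fixed fraction \<open>a\<^sub>k / a\<close> of the total.
\<close>

lemma multinomial_decrease:
  assumes "finite S" "k \<in> S" "a k > 0"
  shows "of_nat (sum a S) * multinomial S (a(k := a k - 1)) = of_nat (a k) * multinomial S a"
proof -
  define P where "P = (\<Prod>i\<in>S. (fact ((a(k := a k - 1)) i) :: rat))"
  have sum: "sum (a(k := a k - 1)) S = sum a S - 1" "sum a S > 0"
    using assms by (simp_all add: sum.remove[of S k])
  have "(\<Prod>i\<in>S. fact (a i)) = of_nat (a k) * P"
    using assms by (simp add: P_def prod.remove[of S k] fact_reduce[of "a k"])
  moreover have "P \<noteq> 0" unfolding P_def using assms(1) by (subst prod_zero_iff) auto
  ultimately have "of_nat (a k) * multinomial S a = fact (sum a S) / P"
    using assms(3) by (simp add: multinomial_def)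
  moreover have "fact (sum a S) = (of_nat (sum a S) * fact (sum a S - 1) :: rat)"
    using sum(2) by (rule fact_reduce)
  moreover have "multinomial S (a(k := a k - 1)) = fact (sum a S - 1) / P"
    unfolding multinomial_def sum(1) P_def ..
  ultimately show ?thesis by (simp only: times_divide_eq_right)
qed

text \<open>
  The recursion turns a conjectured closed form \<open>f a * multinomial S a\<close> into the statement that
  \<open>f a\<close> is the average of its values at the lowered exponent vectors, with weights
  \<open>a\<^sub>k\<close>.
\<close>

lemma CT_dyson_step:
  assumes "finite S" "S \<noteq> {}" "\<And>k. k \<in> S \<Longrightarrow> a k > 0"
    and IH: "\<And>k. k \<in> S \<Longrightarrow> CT (M * dyson S (a(k := a k - 1))) =
      f (a(k := a k - 1)) * multinomial S (a(k := a k - 1))"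
    and f: "(\<Sum>k\<in>S. of_nat (a k) * f (a(k := a k - 1))) = of_nat (sum a S) * f a"
  shows "CT (M * dyson S a) = f a * multinomial S a"
proof -
  have pos: "sum a S > 0" using assms(1-3) by (intro sum_pos) auto
  have "of_nat (sum a S) * CT (M * dyson S a)
      = (\<Sum>k\<in>S. f (a(k := a k - 1)) * (of_nat (sum a S) * multinomial S (a(k := a k - 1))))"
    using assms(1-3)
    by (simp add: dyson_recursion CT_sum IH sum_distrib_left mult_ac del: of_nat_sum One_nat_def)
  also have "\<dots> = (\<Sum>k\<in>S. of_nat (a k) * f (a(k := a k - 1)) * multinomial S a)"
    using assms(1,3) by (intro sum.cong refl) (simp only: multinomial_decrease mult_ac)
  also have "\<dots> = (\<Sum>k\<in>S. of_nat (a k) * f (a(k := a k - 1))) * multinomial S a"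
    by (simp only: sum_distrib_right)
  also have "\<dots> = of_nat (sum a S) * (f a * multinomial S a)"
    by (simp only: f mult.assoc)
  finally show ?thesis using pos by (simp del: of_nat_sum)
qed

text \<open>
  Either some exponent vanishes and its variable can be deleted, or all exponents are positive and
  can be lowered; both decrease the number of variables plus the total exponent.
\<close>

lemma dyson_induct [consumes 1, case_names empty remove step]:
  fixes a :: "nat \<Rightarrow> nat"
  assumes "finite S"
    and empty: "\<And>a. P {} a"
    and remove: "\<And>S a k. finite S \<Longrightarrow> k \<in> S \<Longrightarrow> a k = 0 \<Longrightarrow> P (S - {k}) a \<Longrightarrow> P S a"
    and step: "\<And>S a. finite S \<Longrightarrow> S \<noteq> {} \<Longrightarrow> (\<And>k. k \<in> S \<Longrightarrow> a k > 0) \<Longrightarrow>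
      (\<And>k. k \<in> S \<Longrightarrow> P S (a(k := a k - 1))) \<Longrightarrow> P S a"
  shows "P S a"
  using assms(1)
proof (induction "card S + sum a S" arbitrary: S a rule: less_induct)
  case less
  consider "S = {}" | k where "k \<in> S" "a k = 0" | "S \<noteq> {}" "\<And>k. k \<in> S \<Longrightarrow> a k > 0" by auto
  then show ?case
  proof cases
    case 2
    have "card (S - {k}) + sum a (S - {k}) < card S + sum a S"
      using 2 less.prems by (intro add_less_le_mono card_Diff1_less sum_mono2) auto
    from less.hyps[OF this] show ?thesis using 2 less.prems by (intro remove[of S k]) simp_all
  next
    case 3
    have "sum (a(k := a k - 1)) S < sum a S" if "k \<in> S" for k
      using 3(2)[OF that] that less.prems by (simp add: sum.remove[of S k])
    then have "P S (a(k := a k - 1))" if "k \<in> S" for k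
      using that less.prems by (intro less.hyps) simp_all
    with 3 show ?thesis by (rule step[OF less.prems])
  qed (simp add: empty)
qed

section \<open>The closed forms\<close>

definition rest :: "nat set \<Rightarrow> (nat \<Rightarrow> nat) \<Rightarrow> nat \<Rightarrow> rat" where
  "rest S a r = of_nat (sum a (S - {r}))"

definition ratio :: "nat set \<Rightarrow> (nat \<Rightarrow> nat) \<Rightarrow> nat \<Rightarrow> nat \<Rightarrow> rat" where
  "ratio S a r i = of_nat (a i) / (1 + rest S a r - of_nat (a i))"

text \<open>
  The closed form of the constant term of \<open>x\<^sub>s / x\<^sub>r\<close> times the Dyson product, as a
  multiple of the multinomial coefficient.
\<close>

definition linear_ct :: "nat set \<Rightarrow> (nat \<Rightarrow> nat) \<Rightarrow> nat \<Rightarrow> rat" where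
  "linear_ct S a r = - of_nat (a r) / (1 + rest S a r)"

text \<open>
  The dependence of the quadratic constant term on \<open>s\<close> and \<open>t\<close>. Summing over the indices
  other than \<open>r, s, t\<close>, instead of subtracting from the full sum, ensures that every occurring
  ratio keeps a positive denominator when an exponent is lowered.
\<close>

definition pair_correction :: "nat set \<Rightarrow> (nat \<Rightarrow> nat) \<Rightarrow> nat \<Rightarrow> nat \<Rightarrow> nat \<Rightarrow> rat" where
  "pair_correction S a r s t = - of_bool (s = t) - (\<Sum>i\<in>S - {r, s, t}. ratio S a r i)"

text \<open>
  The closed form of the constant term of \<open>x\<^sub>s x\<^sub>t / x\<^sub>r\<^sup>2\<close> times the Dyson product, for
  \<open>s, t\<close> distinct from \<open>r\<close> but possibly equal, as a multiple of the multinomial coefficient.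
\<close>

definition quadratic_ct :: "nat set \<Rightarrow> (nat \<Rightarrow> nat) \<Rightarrow> nat \<Rightarrow> nat \<Rightarrow> nat \<Rightarrow> rat" where
  "quadratic_ct S a r s t = of_nat (a r) / ((1 + rest S a r) * (2 + rest S a r)) *
     (2 * of_nat (a r) + rest S a r + (1 + of_nat (a r) + rest S a r) * pair_correction S a r s t)"

lemma rest_nonneg: "rest S a r \<ge> 0"
  by (simp add: rest_def del: of_nat_sum)

lemma le_rest: "finite S \<Longrightarrow> i \<in> S - {r} \<Longrightarrow> of_nat (a i) \<le> rest S a r"
  unfolding rest_def of_nat_le_iff by (rule member_le_sum) auto

lemma sum_rest: "(\<Sum>i\<in>S - {r}. of_nat (a i)) = rest S a r"
  by (simp add: rest_def)

lemma of_nat_sum_eq: "finite S \<Longrightarrow> r \<in> S \<Longrightarrow> of_nat (sum a S) = of_nat (a r) + rest S a r"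
  by (simp add: rest_def sum.remove[of S r])

lemma rest_remove: "finite S \<Longrightarrow> k \<in> S \<Longrightarrow> k \<noteq> r \<Longrightarrow> a k = 0 \<Longrightarrow> rest (S - {k}) a r = rest S a r"
  unfolding rest_def by (intro arg_cong[where f = of_nat] sum.mono_neutral_left) auto

lemma rest_decrease_self: "rest S (a(r := a r - 1)) r = rest S a r"
  by (auto simp: rest_def intro!: sum.cong)

lemma rest_decrease:
  assumes "finite S" "k \<in> S - {r}" "a k > 0"
  shows "rest S (a(k := a k - 1)) r = rest S a r - 1"
proof -
  have "sum (a(k := a k - 1)) (S - {r}) + 1 = sum a (S - {r})"
    using assms by (simp add: sum.remove[of "S - {r}" k])
  then show ?thesis unfolding rest_def by (metis add_diff_cancel_right' of_nat_1 of_nat_add)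
qed

lemma weight_times_ratio:
  assumes "finite S" "i \<in> S - {r}"
  shows "of_nat (a i) * ratio S a r i = (1 + rest S a r) * ratio S a r i - of_nat (a i)"
proof -
  have "1 + rest S a r - of_nat (a i) \<noteq> 0" using le_rest[OF assms, of a] by simp
  then show ?thesis by (simp add: ratio_def field_simps)
qed

lemma one_plus_ratio:
  assumes "finite S" "i \<in> S - {r}"
  shows "1 + ratio S a r i = (1 + rest S a r) / (1 + rest S a r - of_nat (a i))"
proof -
  have "1 + rest S a r - of_nat (a i) \<noteq> 0" using le_rest[OF assms, of a] by simp
  then show ?thesis by (simp add: ratio_def field_simps)
qed

text \<open>
  In this form the dependence on \<open>s\<close> and \<open>t\<close> is separated, which makes sums over \<open>s\<close> or
  \<open>t\<close> and alternating combinations easy.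
\<close>

lemma pair_correction_expand:
  assumes "finite S" "s \<in> S - {r}" "t \<in> S - {r}"
  shows "pair_correction S a r s t = ratio S a r s + ratio S a r t - (\<Sum>i\<in>S - {r}. ratio S a r i)
    - of_bool (s = t) * (1 + ratio S a r s)"
proof (cases "s = t")
  case True
  have "S - {r, s, t} = S - {r} - {s}" using True by auto
  then show ?thesis using assms True by (simp add: pair_correction_def sum.remove[of "S - {r}" s])
next
  case False
  have "S - {r, s, t} = S - {r} - {s} - {t}" by auto
  then show ?thesis using assms False
    by (simp add: pair_correction_def sum.remove[of "S - {r}" s] sum.remove[of "S - {r} - {s}" t])
qed

text \<open>
  Summation of the expanded form; \<open>weight_times_ratio\<close> turns weighted sums of ratios into
  unweighted ones.
\<close>

lemma sum_pair_correction:
  assumes "finite S" "t \<in> S - {r}"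
  shows "(\<Sum>i\<in>S - {r}. of_nat (a i) * pair_correction S a r i t)
    = (\<Sum>i\<in>S - {r}. ratio S a r i) - ratio S a r t - rest S a r"
proof -
  let ?h = "ratio S a r" and ?m = "rest S a r"
  define H where "H = (\<Sum>i\<in>S - {r}. ?h i)"
  have "(\<Sum>i\<in>S - {r}. of_nat (a i) * pair_correction S a r i t)
      = (\<Sum>i\<in>S - {r}. (1 + ?m) * ?h i - of_nat (a i) + of_nat (a i) * (?h t - H)
          - (if i = t then of_nat (a i) + of_nat (a i) * ?h i else 0))"
    using assms
    by (intro sum.cong refl)
      (auto simp: pair_correction_expand weight_times_ratio H_def[symmetric] algebra_simps)
  also have "\<dots> = (1 + ?m) * H - ?m + ?m * (?h t - H)
      - (of_nat (a t) + of_nat (a t) * ?h t)"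
    using assms
    by (simp add: sum.distrib sum_subtractf sum.delta H_def sum_rest
        flip: sum_distrib_left sum_distrib_right)
  also have "\<dots> = H - ?h t - ?m"
    using weight_times_ratio[OF assms, of a] by (simp add: algebra_simps)
  finally show ?thesis by (simp add: H_def)
qed

lemma sum_pair_correction_diag:
  assumes "finite S"
  shows "(\<Sum>i\<in>S - {r}. of_nat (a i) * pair_correction S a r i i)
    = (\<Sum>i\<in>S - {r}. ratio S a r i) - 2 * rest S a r"
proof -
  let ?h = "ratio S a r" and ?m = "rest S a r"
  define H where "H = (\<Sum>i\<in>S - {r}. ?h i)"
  have "(\<Sum>i\<in>S - {r}. of_nat (a i) * pair_correction S a r i i)
      = (\<Sum>i\<in>S - {r}. (1 + ?m) * ?h i - of_nat (a i) - of_nat (a i) * (H + 1))"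
    using assms
    by (intro sum.cong refl)
      (auto simp: pair_correction_expand weight_times_ratio H_def[symmetric] algebra_simps)
  also have "\<dots> = (1 + ?m) * H - ?m - ?m * (H + 1)"
    by (simp add: sum_subtractf H_def sum_rest flip: sum_distrib_left sum_distrib_right)
  finally show ?thesis by (simp add: H_def algebra_simps)
qed

lemma pair_correction_remove:
  assumes "finite S" "k \<in> S - {r}" "a k = 0"
  shows "pair_correction S a r s t = - of_bool (s = t) - (\<Sum>i\<in>S - {k} - {r, s, t}. ratio (S - {k}) a r i)"
proof -
  have "ratio S a r i = ratio (S - {k}) a r i" for i
    using assms by (simp add: ratio_def rest_remove)
  moreover have "ratio S a r k = 0" using assms by (simp add: ratio_def)
  then have "(\<Sum>i\<in>S - {k} - {r, s, t}. ratio S a r i) = (\<Sum>i\<in>S - {r, s, t}. ratio S a r i)"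
    using assms by (intro sum.mono_neutral_left) auto
  ultimately show ?thesis by (simp add: pair_correction_def)
qed

section \<open>Boundary conditions of the closed forms\<close>

text \<open>
  For \<open>a\<^sub>s = 0\<close> the coefficient of \<open>1 / x\<^sub>s\<close> is \<open>- \<Sum>\<^sub>i a\<^sub>i x\<^sub>i\<close>. The
  term \<open>i = r\<close> cancels the denominator \<open>x\<^sub>r\<close> and contributes \<open>a\<^sub>r\<close>, the others contribute
  linear constant terms in one variable less.
\<close>

lemma linear_boundary:
  assumes "finite S" "s \<in> S" "r \<in> S" "s \<noteq> r" "a s = 0"
  shows "- (of_nat (a r) + (\<Sum>i\<in>S - {s} - {r}. of_nat (a i) * linear_ct (S - {s}) a r)) = linear_ct S a r"
proof -
  have "1 + rest S a r \<noteq> 0" using rest_nonneg[of S a r] by linarith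
  then show ?thesis using assms
    by (simp add: linear_ct_def sum_rest rest_remove divide_simps
        flip: sum_distrib_right sum_divide_distrib sum_negf del: of_nat_sum)
      (simp add: algebra_simps)
qed

text \<open>
  The same replacement of \<open>x\<^sub>s\<close> as in the linear case; now the term \<open>i = r\<close> is a linear
  constant term and the others are quadratic ones.
\<close>

lemma quadratic_boundary_distinct:
  assumes "finite S" "s \<in> S" "r \<in> S" "t \<in> S" "s \<noteq> r" "t \<noteq> r" "s \<noteq> t" "a s = 0"
  defines "T \<equiv> S - {s}"
  shows "- (of_nat (a r) * linear_ct T a r + (\<Sum>i\<in>T - {r}. of_nat (a i) * quadratic_ct T a r i t))
    = quadratic_ct S a r s t"
proof -
  define A m Y where "A = (of_nat (a r) :: rat)" and "m = rest S a r" and "Y = pair_correction S a r s t"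
  have m: "1 + m > 0" "2 + m > 0" using rest_nonneg[of S a r] by (simp_all add: m_def)
  have mT: "rest T a r = m" using assms by (simp add: T_def m_def rest_remove)
  define K where "K = A / ((1 + m) * (2 + m))"
  have "S - {s} - {r, s, t} = T - {r} - {t}" by (auto simp: T_def)
  then have "Y = - (\<Sum>i\<in>T - {r} - {t}. ratio T a r i)"
    using assms(1-8) unfolding Y_def by (subst pair_correction_remove[of S s]) (auto simp: T_def)
  then have Y: "(\<Sum>i\<in>T - {r}. of_nat (a i) * pair_correction T a r i t) = - Y - m"
    using assms(1-8) mT by (simp add: sum_pair_correction T_def sum.remove[of "S - {s} - {r}" t])
  have q: "quadratic_ct T a r i t = K * (2 * A + m + (1 + A + m) * pair_correction T a r i t)" for i
    by (simp add: quadratic_ct_def mT K_def A_def)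
  have "(\<Sum>i\<in>T - {r}. of_nat (a i) * quadratic_ct T a r i t)
     = (\<Sum>i\<in>T - {r}. of_nat (a i) * (K * (2 * A + m))
          + K * (1 + A + m) * (of_nat (a i) * pair_correction T a r i t))"
    by (intro sum.cong refl) (simp add: q algebra_simps)
  also have "\<dots> = m * (K * (2 * A + m)) + K * (1 + A + m) * (- Y - m)"
    by (simp add: sum.distrib Y sum_rest mT flip: sum_distrib_left sum_distrib_right)
  finally have sum: "(\<Sum>i\<in>T - {r}. of_nat (a i) * quadratic_ct T a r i t) = \<dots>" .
  have lin: "linear_ct T a r = - (K * (2 + m))"
    using m by (simp add: linear_ct_def mT K_def A_def)
  have "quadratic_ct S a r s t = K * (2 * A + m + (1 + A + m) * Y)"
    by (simp add: quadratic_ct_def K_def A_def m_def Y_def)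
  then show ?thesis
    unfolding sum lin by (simp add: A_def[symmetric] algebra_simps)
qed

text \<open>
  Here \<open>x\<^sub>s\<^sup>2\<close> is replaced by \<open>((\<Sum>\<^sub>i a\<^sub>i x\<^sub>i)\<^sup>2 - \<Sum>\<^sub>i a\<^sub>i
  x\<^sub>i\<^sup>2) / 2\<close>. The terms of the square are sorted by whether both, one or none of the two
  factors is \<open>x\<^sub>r\<close>.
\<close>

lemma quadratic_boundary_equal:
  assumes "finite S" "s \<in> S" "r \<in> S" "s \<noteq> r" "a s = 0"
  defines "T \<equiv> S - {s}"
  shows "(of_nat (a r))\<^sup>2 + 2 * of_nat (a r) * (\<Sum>i\<in>T - {r}. of_nat (a i) * linear_ct T a r)
      + (\<Sum>i\<in>T - {r}. \<Sum>j\<in>T - {r}. of_nat (a i) * of_nat (a j) * quadratic_ct T a r i j)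
      - (of_nat (a r) + (\<Sum>i\<in>T - {r}. of_nat (a i) * quadratic_ct T a r i i))
    = 2 * quadratic_ct S a r s s"
proof -
  define A m H where "A = (of_nat (a r) :: rat)" and "m = rest S a r"
    and "H = (\<Sum>i\<in>T - {r}. ratio T a r i)"
  have m: "1 + m > 0" "2 + m > 0" using rest_nonneg[of S a r] by (simp_all add: m_def)
  have mT: "rest T a r = m" using assms by (simp add: T_def m_def rest_remove)
  have finT: "finite T" using assms by (simp add: T_def)
  define K where "K = A / ((1 + m) * (2 + m))"
  have q: "quadratic_ct T a r i j = K * (2 * A + m + (1 + A + m) * pair_correction T a r i j)" for i j
    by (simp add: quadratic_ct_def mT K_def A_def)
  have "S - {s} - {r, s, s} = T - {r}" by (auto simp: T_def)
  then have Y: "pair_correction S a r s s = - 1 - H"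
    using assms(1-5) unfolding H_def by (subst pair_correction_remove[of S s]) (auto simp: T_def)
  have diag: "(\<Sum>i\<in>T - {r}. of_nat (a i) * quadratic_ct T a r i i)
     = m * (K * (2 * A + m)) + K * (1 + A + m) * (H - 2 * m)"
  proof -
    have "(\<Sum>i\<in>T - {r}. of_nat (a i) * quadratic_ct T a r i i)
       = (\<Sum>i\<in>T - {r}. of_nat (a i) * (K * (2 * A + m))
            + K * (1 + A + m) * (of_nat (a i) * pair_correction T a r i i))"
      by (intro sum.cong refl) (simp add: q algebra_simps)
    also have "\<dots> = m * (K * (2 * A + m)) + K * (1 + A + m) * (H - 2 * m)"
      using finT by (simp add: sum.distrib sum_pair_correction_diag sum_rest mT H_def
          flip: sum_distrib_left sum_distrib_right)
    finally show ?thesis .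
  qed
  have ratios: "(\<Sum>j\<in>T - {r}. of_nat (a j) * ratio T a r j) = (1 + m) * H - m"
    using finT by (simp add: weight_times_ratio sum_subtractf sum_rest mT H_def
        flip: sum_distrib_left)
  have "(\<Sum>i\<in>T - {r}. \<Sum>j\<in>T - {r}. of_nat (a i) * of_nat (a j) * quadratic_ct T a r i j)
      = (\<Sum>j\<in>T - {r}. \<Sum>i\<in>T - {r}. of_nat (a j) * (of_nat (a i) * (K * (2 * A + m))
            + K * (1 + A + m) * (of_nat (a i) * pair_correction T a r i j)))"
    by (subst sum.swap, intro sum.cong refl) (simp add: q algebra_simps)
  also have "\<dots> = (\<Sum>j\<in>T - {r}. of_nat (a j) * (m * (K * (2 * A + m))
       + K * (1 + A + m) * (H - m)) - K * (1 + A + m) * (of_nat (a j) * ratio T a r j))"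
    using finT by (intro sum.cong refl)
      (simp add: sum.distrib sum_pair_correction sum_rest mT H_def algebra_simps
        flip: sum_distrib_left sum_distrib_right)
  also have "\<dots> = m * (m * (K * (2 * A + m)) + K * (1 + A + m) * (H - m))
      - K * (1 + A + m) * ((1 + m) * H - m)"
    by (simp add: sum_subtractf ratios sum_rest mT flip: sum_distrib_left sum_distrib_right)
  finally have double: "(\<Sum>i\<in>T - {r}. \<Sum>j\<in>T - {r}. of_nat (a i) * of_nat (a j) * quadratic_ct T a r i j)
     = \<dots>" .
  have "(\<Sum>i\<in>T - {r}. of_nat (a i) * linear_ct T a r) = m * linear_ct T a r"
    by (simp only: sum_rest mT flip: sum_distrib_right)
  also have "\<dots> = - (m * K * (2 + m))"
    using m by (simp add: linear_ct_def mT K_def A_def)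
  finally have lin: "(\<Sum>i\<in>T - {r}. of_nat (a i) * linear_ct T a r) = \<dots>" .
  \<comment> \<open>Once \<open>a\<^sub>r\<close> itself is written as a multiple of \<open>K\<close>, the claim is a polynomial identity.\<close>
  have A: "A = K * ((1 + m) * (2 + m))" using m by (simp add: K_def)
  have Asq: "A\<^sup>2 = K * A * ((1 + m) * (2 + m))" using A by (simp add: power2_eq_square)
  have "quadratic_ct S a r s s = K * (2 * A + m + (1 + A + m) * (- 1 - H))"
    by (simp add: quadratic_ct_def K_def A_def m_def Y)
  moreover have "A\<^sup>2 + 2 * A * - (m * K * (2 + m)) +
     (m * (m * (K * (2 * A + m)) + K * (1 + A + m) * (H - m)) - K * (1 + A + m) * ((1 + m) * H - m)) -
     (A + (m * (K * (2 * A + m)) + K * (1 + A + m) * (H - 2 * m))) =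
     2 * (K * (2 * A + m + (1 + A + m) * (- 1 - H)))"
    unfolding Asq by (subst (6) A) (simp add: algebra_simps)
  ultimately show ?thesis
    unfolding lin double diag by (simp only: A_def[symmetric])
qed

section \<open>The closed forms satisfy the recursion\<close>

text \<open>
  Lowering an exponent other than \<open>a\<^sub>r\<close> only changes \<open>rest\<close>, so all these lowered values
  agree.
\<close>

lemma linear_step:
  assumes "finite S" "r \<in> S" "S \<noteq> {r}" "\<And>k. k \<in> S \<Longrightarrow> a k > 0"
  shows "(\<Sum>k\<in>S. of_nat (a k) * linear_ct S (a(k := a k - 1)) r) = of_nat (sum a S) * linear_ct S a r"
proof -
  define A m where "A = (of_nat (a r) :: rat)" and "m = rest S a r"
  have "sum a (S - {r}) > 0" using assms by (intro sum_pos) auto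
  then have m: "m > 0" by (simp add: m_def rest_def del: of_nat_sum)
  have other: "linear_ct S (a(k := a k - 1)) r = - A / m" if "k \<in> S - {r}" for k
    using that assms by (simp add: linear_ct_def rest_decrease A_def m_def del: One_nat_def)
  have pred: "of_nat (a r - 1) = A - 1"
    using assms(4)[of r] assms(2) by (simp add: A_def of_nat_diff Suc_le_eq)
  have self: "linear_ct S (a(r := a r - 1)) r = - (A - 1) / (1 + m)"
    using assms by (simp add: linear_ct_def rest_decrease_self pred m_def
        del: One_nat_def)
  have "(\<Sum>k\<in>S - {r}. of_nat (a k) * linear_ct S (a(k := a k - 1)) r)
     = (\<Sum>k\<in>S - {r}. of_nat (a k) * (- A / m))"
    by (intro sum.cong refl) (simp only: other)
  also have "\<dots> = m * (- A / m)"
    by (simp only: sum_rest m_def flip: sum_distrib_right)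
  finally have "(\<Sum>k\<in>S. of_nat (a k) * linear_ct S (a(k := a k - 1)) r)
     = A * (- (A - 1) / (1 + m)) + m * (- A / m)"
    using assms by (simp only: sum.remove[of S r] self A_def)
  also have "\<dots> = (A + m) * linear_ct S a r"
    using m by (simp add: linear_ct_def A_def[symmetric] m_def[symmetric] field_simps)
  finally show ?thesis using assms by (simp add: of_nat_sum_eq[of S r] A_def m_def del: of_nat_sum)
qed

text \<open>
  The ratio is its own average over the exponents other than \<open>a\<^sub>r\<close>. A further index \<open>s\<close>
  with positive exponent is needed to keep the denominator
  \<open>rest S a r - a\<^sub>i\<close> of the lowered ratios away from 0.
\<close>

lemma ratio_step:
  assumes "finite S" "i \<in> S - {r}" "s \<in> S - {r}" "s \<noteq> i" "\<And>k. k \<in> S \<Longrightarrow> a k > 0"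
  shows "(\<Sum>k\<in>S - {r}. of_nat (a k) * ratio S (a(k := a k - 1)) r i) = rest S a r * ratio S a r i"
proof -
  define m x where "m = rest S a r" and "x = (of_nat (a i) :: rat)"
  have "m = x + of_nat (sum a (S - {r} - {i}))"
    using assms by (simp add: m_def x_def rest_def sum.remove[of "S - {r}" i])
  moreover have "sum a (S - {r} - {i}) > 0" using assms by (intro sum_pos) auto
  ultimately have mx: "m - x > 0" and rest': "(\<Sum>k\<in>S - {r} - {i}. of_nat (a k)) = m - x"
    by (simp_all del: of_nat_sum) simp
  have other: "ratio S (a(k := a k - 1)) r i = x / (m - x)" if "k \<in> S - {r} - {i}" for k
    using that assms by (simp add: ratio_def rest_decrease x_def m_def del: One_nat_def)
  have pred: "of_nat (a i - 1) = x - 1"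
    using assms(5)[of i] assms(2) by (simp add: x_def of_nat_diff Suc_le_eq)
  have self: "ratio S (a(i := a i - 1)) r i = (x - 1) / (1 + m - x)"
    using assms by (simp add: ratio_def rest_decrease pred m_def algebra_simps
        del: One_nat_def)
  have "(\<Sum>k\<in>S - {r}. of_nat (a k) * ratio S (a(k := a k - 1)) r i)
      = x * ((x - 1) / (1 + m - x)) + (m - x) * (x / (m - x))"
    using assms by (simp add: sum.remove[of "S - {r}" i] self other rest' x_def[symmetric]
        del: One_nat_def flip: sum_distrib_right sum_divide_distrib)
  also have "\<dots> = m * (x / (1 + m - x))"
  proof -
    have "(m - x) * (x / (m - x)) = x" "1 + m - x \<noteq> 0" using mx by simp_all
    then show ?thesis by (simp only:) (simp add: field_simps)
  qed
  finally show ?thesis by (simp add: ratio_def m_def x_def)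
qed

lemma pair_correction_step:
  assumes "finite S" "s \<in> S - {r}" "\<And>k. k \<in> S \<Longrightarrow> a k > 0"
  shows "(\<Sum>k\<in>S - {r}. of_nat (a k) * pair_correction S (a(k := a k - 1)) r s t) = rest S a r * pair_correction S a r s t"
proof -
  have "(\<Sum>k\<in>S - {r}. of_nat (a k) * pair_correction S (a(k := a k - 1)) r s t)
    = (\<Sum>k\<in>S - {r}. of_nat (a k) * - of_bool (s = t)) -
      (\<Sum>i\<in>S - {r, s, t}. \<Sum>k\<in>S - {r}. of_nat (a k) * ratio S (a(k := a k - 1)) r i)"
    by (subst sum.swap)
      (simp add: pair_correction_def algebra_simps sum_distrib_left del: One_nat_def flip: sum_subtractf sum.distrib)
  also have "\<dots> = rest S a r * - of_bool (s = t) - (\<Sum>i\<in>S - {r, s, t}. rest S a r * ratio S a r i)"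
    using assms by (intro arg_cong2[where f = minus] sum.cong refl ratio_step[where s = s])
      (auto simp: sum_rest sum_negf simp flip: sum_distrib_right)
  finally show ?thesis by (simp add: pair_correction_def algebra_simps sum_distrib_left)
qed

text \<open>
  Since the pair correction is its own average over the exponents other than \<open>a\<^sub>r\<close>, and is
  unaffected by lowering \<open>a\<^sub>r\<close>, it behaves like a constant \<open>Y\<close> throughout.
\<close>

lemma quadratic_step:
  assumes "finite S" "r \<in> S" "s \<in> S - {r}" "\<And>k. k \<in> S \<Longrightarrow> a k > 0"
  shows "(\<Sum>k\<in>S. of_nat (a k) * quadratic_ct S (a(k := a k - 1)) r s t)
    = of_nat (sum a S) * quadratic_ct S a r s t"
proof -
  define A m Y where "A = (of_nat (a r) :: rat)" and "m = rest S a r" and "Y = pair_correction S a r s t"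
  have "sum a (S - {r}) > 0" using assms by (intro sum_pos) auto
  then have m: "m > 0" by (simp add: m_def rest_def del: of_nat_sum)
  define K where "K = A / (m * (1 + m))"
  have other: "quadratic_ct S (a(k := a k - 1)) r s t = K *
      (2 * A + m - 1 + (A + m) * pair_correction S (a(k := a k - 1)) r s t)" if "k \<in> S - {r}" for k
    using that assms by (simp add: quadratic_ct_def rest_decrease A_def m_def K_def algebra_simps
        del: One_nat_def)
  have "ratio S (a(r := a r - 1)) r i = ratio S a r i" if "i \<noteq> r" for i
    using that by (simp add: ratio_def rest_decrease_self del: One_nat_def)
  then have "pair_correction S (a(r := a r - 1)) r s t = Y"
    by (simp add: pair_correction_def Y_def del: One_nat_def)
  moreover have pred: "of_nat (a r - 1) = A - 1"
    using assms(4)[of r] assms(2) by (simp add: A_def of_nat_diff Suc_le_eq)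
  ultimately have self: "quadratic_ct S (a(r := a r - 1)) r s t = (A - 1) / ((1 + m) * (2 + m)) *
      (2 * (A - 1) + m + (A + m) * Y)"
    using assms by (simp add: quadratic_ct_def rest_decrease_self pred m_def
        del: One_nat_def)
  have "(\<Sum>k\<in>S - {r}. of_nat (a k) * quadratic_ct S (a(k := a k - 1)) r s t)
     = (\<Sum>k\<in>S - {r}. of_nat (a k) * (K * (2 * A + m - 1)) + K * (A + m) * (of_nat (a k) * pair_correction S (a(k := a k - 1)) r s t))"
    by (intro sum.cong refl) (simp only: other, simp add: algebra_simps del: One_nat_def)
  also have "\<dots> = m * (K * (2 * A + m - 1)) + K * (A + m) * (m * Y)"
    using pair_correction_step[OF assms(1,3,4), where t = t]
    by (simp add: sum.distrib sum_rest m_def Y_def del: One_nat_def flip: sum_distrib_right sum_distrib_left)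
  also have "\<dots> = A / ((1 + m) * (2 + m)) * (2 + m) * (2 * A + m - 1 + (A + m) * Y)"
  proof -
    have "m * K = A / ((1 + m) * (2 + m)) * (2 + m)" using m by (simp add: K_def)
    moreover have "m * (K * (2 * A + m - 1)) + K * (A + m) * (m * Y) = m * K * (2 * A + m - 1 + (A + m) * Y)"
      by (simp add: algebra_simps)
    ultimately show ?thesis by (simp only:)
  qed
  finally have others: "(\<Sum>k\<in>S - {r}. of_nat (a k) * quadratic_ct S (a(k := a k - 1)) r s t) = \<dots>" .
  have "(\<Sum>k\<in>S. of_nat (a k) * quadratic_ct S (a(k := a k - 1)) r s t)
      = A * ((A - 1) / ((1 + m) * (2 + m)) * (2 * (A - 1) + m + (A + m) * Y))
        + A / ((1 + m) * (2 + m)) * (2 + m) * (2 * A + m - 1 + (A + m) * Y)"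
    using assms by (simp only: sum.remove[of S r] self others) (simp add: A_def)
  also have "\<dots> = A / ((1 + m) * (2 + m)) * ((A - 1) * (2 * (A - 1) + m + (A + m) * Y)
      + (2 + m) * (2 * A + m - 1 + (A + m) * Y))"
  proof -
    have "A * ((A - 1) / c * x) + A / c * (2 + m) * y = A / c * ((A - 1) * x + (2 + m) * y)"
      for c x y :: rat by (simp add: divide_inverse algebra_simps)
    then show ?thesis .
  qed
  also have "(A - 1) * (2 * (A - 1) + m + (A + m) * Y) + (2 + m) * (2 * A + m - 1 + (A + m) * Y)
      = (A + m) * (2 * A + m + (1 + A + m) * Y)"
    by (simp add: algebra_simps)
  also have "A / ((1 + m) * (2 + m)) * ((A + m) * (2 * A + m + (1 + A + m) * Y))
      = of_nat (sum a S) * quadratic_ct S a r s t"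
    using assms by (simp add: of_nat_sum_eq[of S r] quadratic_ct_def A_def m_def Y_def del: of_nat_sum)
  finally show ?thesis .
qed

section \<open>Constant terms\<close>

text \<open>
  Dyson's constant term identity, by Good's argument.
\<close>

lemma CT_dyson:
  assumes "finite S"
  shows "CT (dyson S a) = multinomial S a"
  using assms
proof (induction S a rule: dyson_induct)
  case (empty a)
  show ?case by (simp add: dyson_def multinomial_def)
next
  case (remove S a k)
  then show ?case
    using CT_dyson_remove(1)[of S k a 1] by (simp add: exps_in_1 multinomial_remove)
next
  case (step S a)
  have "CT (1 * dyson S a) = 1 * multinomial S a"
    by (rule CT_dyson_step[where f = "\<lambda>_. 1"])
      (use step in \<open>simp_all del: fun_upd_apply One_nat_def\<close>)
  then show ?case by simp
qed

lemma CT_dyson_linear: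
  assumes "finite S" "r \<in> S" "s \<in> S" "s \<noteq> r"
  shows "CT (X s * X_pow r (- 1) * dyson S a) = linear_ct S a r * multinomial S a"
proof -
  have "r \<in> S \<longrightarrow> s \<in> S - {r} \<longrightarrow>
      CT (X s * X_pow r (- 1) * dyson S a) = linear_ct S a r * multinomial S a"
    using assms(1)
  proof (induction S a arbitrary: s rule: dyson_induct)
    case (remove S a k)
    show ?case
    proof (intro impI)
      assume *: "r \<in> S" "s \<in> S - {r}"
      consider "k = r" | "k = s" "k \<noteq> r" | "k \<noteq> r" "k \<noteq> s" by auto
      then show "CT (X s * X_pow r (- 1) * dyson S a) = linear_ct S a r * multinomial S a"
      proof cases
        case 1
        then have "CT (X s * X_pow r (- 1) * dyson S a) = 0"
          using remove.hyps * by (intro CT_dyson_negative_power[of S r] exps_in_mult[where E = "{0}" and F = "{- 1}"]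
              exps_in_X_pow) auto
        then show ?thesis using 1 remove by (simp add: linear_ct_def)
      next
        case 2
        have "CT (X k * X_pow r (- 1) * dyson S a)
            = - (\<Sum>i\<in>S - {k}. of_nat (a i) * CT (X i * X_pow r (- 1) * dyson (S - {k}) a))"
          using 2 remove.hyps by (intro CT_dyson_remove exps_in_X_pow) auto
        also have "(\<Sum>i\<in>S - {k}. of_nat (a i) * CT (X i * X_pow r (- 1) * dyson (S - {k}) a))
            = of_nat (a r) * CT (X r * X_pow r (- 1) * dyson (S - {k}) a)
              + (\<Sum>i\<in>S - {k} - {r}. of_nat (a i) * CT (X i * X_pow r (- 1) * dyson (S - {k}) a))"
          using 2 remove.hyps * by (intro sum.remove) auto
        also have "(\<Sum>i\<in>S - {k} - {r}. of_nat (a i) * CT (X i * X_pow r (- 1) * dyson (S - {k}) a))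
            = (\<Sum>i\<in>S - {k} - {r}. of_nat (a i) * linear_ct (S - {k}) a r) * multinomial S a"
          unfolding sum_distrib_right
          using 2 remove * by (intro sum.cong refl) (simp add: multinomial_remove)
        also have "CT (X r * X_pow r (- 1) * dyson (S - {k}) a) = multinomial S a"
          using remove.hyps by (simp add: X_pow_add CT_dyson multinomial_remove)
        finally have "CT (X k * X_pow r (- 1) * dyson S a) = - (of_nat (a r) + (\<Sum>i\<in>S - {k} - {r}.
            of_nat (a i) * linear_ct (S - {k}) a r)) * multinomial S a"
          by (simp add: algebra_simps)
        then show ?thesis using linear_boundary[of S k r a] 2 remove.hyps * by simp
      next
        case 3
        then have "CT (X s * X_pow r (- 1) * dyson S a) = CT (X s * X_pow r (- 1) * dyson (S - {k}) a)"
          using remove.hyps by (intro CT_dyson_remove exps_in_mult[where E = "{0}" and F = "{0}"] exps_in_X_pow) auto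
        then show ?thesis using 3 remove * by (simp add: multinomial_remove linear_ct_def rest_remove)
      qed
    qed
  next
    case (step S a)
    show ?case
    proof (intro impI)
      assume *: "r \<in> S" "s \<in> S - {r}"
      show "CT (X s * X_pow r (- 1) * dyson S a) = linear_ct S a r * multinomial S a"
      proof (rule CT_dyson_step[where f = "\<lambda>a. linear_ct S a r", OF step.hyps])
        show "CT (X s * X_pow r (- 1) * dyson S (a(k := a k - 1))) =
            linear_ct S (a(k := a k - 1)) r * multinomial S (a(k := a k - 1))" if "k \<in> S" for k
          using step.IH[OF that] * by blast
        show "(\<Sum>k\<in>S. of_nat (a k) * linear_ct S (a(k := a k - 1)) r) =
            of_nat (sum a S) * linear_ct S a r"
          using * by (intro linear_step step.hyps) auto
      qed
    qed
  qed simp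
  then show ?thesis using assms by simp
qed

lemma pair_correction_commute: "pair_correction S a r s t = pair_correction S a r t s"
  by (simp add: pair_correction_def insert_commute eq_commute)

lemma quadratic_ct_commute: "quadratic_ct S a r s t = quadratic_ct S a r t s"
  by (simp add: quadratic_ct_def pair_correction_commute[of S a r s t])

text \<open>
  Good's argument with three boundary situations: \<open>a\<^sub>r = 0\<close> forces the value 0, an exponent
  of a variable absent from the monomial can be dropped, and the variables \<open>x\<^sub>s, x\<^sub>t\<close> are
  eliminated by the boundary lemmas above.
\<close>

lemma CT_dyson_quadratic:
  assumes "finite S" "r \<in> S" "s \<in> S - {r}" "t \<in> S - {r}"
  shows "CT (X s * X t * X_pow r (- 2) * dyson S a) = quadratic_ct S a r s t * multinomial S a"
proof -
  have "r \<in> S \<longrightarrow> s \<in> S - {r} \<longrightarrow> t \<in> S - {r} \<longrightarrow>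
      CT (X s * X t * X_pow r (- 2) * dyson S a) = quadratic_ct S a r s t * multinomial S a"
    using assms(1)
  proof (induction S a arbitrary: s t rule: dyson_induct)
    case (remove S a k)
    let ?T = "S - {k}"
    have mult: "multinomial ?T a = multinomial S a"
      using remove.hyps by (rule multinomial_remove)
    \<comment> \<open>The values after the elimination of \<open>x\<^sub>k\<close>, sorted by how many numerator variables are \<open>x\<^sub>r\<close>.\<close>
    have pair: "CT (X i * X j * X_pow r (- 2) * dyson ?T a) = quadratic_ct ?T a r i j * multinomial S a"
      if "r \<in> ?T" "i \<in> ?T - {r}" "j \<in> ?T - {r}" for i j
      using remove that by (simp add: multinomial_remove)
    have Xr: "X r * X_pow r (- 2) = X_pow r (- 1)" "X r * X_pow r (- 1) = 1" by (simp_all add: X_pow_add)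
    have one: "CT (X r * X j * X_pow r (- 2) * dyson ?T a) = linear_ct ?T a r * multinomial S a"
      if "r \<in> ?T" "j \<in> ?T - {r}" for j
    proof -
      have "X r * X j * X_pow r (- 2) = X j * (X r * X_pow r (- 2))"
        by (simp only: mult_ac)
      then have mon: "X r * X j * X_pow r (- 2) = X j * X_pow r (- 1)"
        by (simp only: Xr)
      have "CT (X j * X_pow r (- 1) * dyson ?T a) = linear_ct ?T a r * multinomial ?T a"
        using that remove.hyps by (intro CT_dyson_linear) auto
      then show ?thesis
        by (simp only: mon mult)
    qed
    have none: "CT (X r * X r * X_pow r (- 2) * dyson ?T a) = multinomial S a"
    proof -
      have mon: "X r * X r * X_pow r (- 2) = 1" by (simp only: mult.assoc Xr)
      have "CT (dyson ?T a) = multinomial ?T a" using remove.hyps by (intro CT_dyson) auto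
      then show ?thesis by (simp only: mon mult_1_left mult)
    qed
    \<comment> \<open>Deleting a variable that occurs to the first power; used for either factor of the monomial.\<close>
    have distinct: "CT (X k * X t * X_pow r (- 2) * dyson S a) = quadratic_ct S a r k t * multinomial S a"
      if *: "r \<in> S" "k \<noteq> r" "t \<in> S - {r}" "t \<noteq> k" for t
    proof -
      have "CT (X k * (X t * X_pow r (- 2)) * dyson S a)
          = - (\<Sum>i\<in>?T. of_nat (a i) * CT (X i * (X t * X_pow r (- 2)) * dyson ?T a))"
        using remove.hyps that
        by (intro CT_dyson_remove exps_in_mult[where E = "{0}" and F = "{0}"] exps_in_X_pow) auto
      also have "(\<Sum>i\<in>?T. of_nat (a i) * CT (X i * (X t * X_pow r (- 2)) * dyson ?T a))
          = of_nat (a r) * CT (X r * (X t * X_pow r (- 2)) * dyson ?T a)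
           + (\<Sum>i\<in>?T - {r}. of_nat (a i) * CT (X i * (X t * X_pow r (- 2)) * dyson ?T a))"
        using remove.hyps that by (intro sum.remove) auto
      also have "\<dots> = (of_nat (a r) * linear_ct ?T a r
           + (\<Sum>i\<in>?T - {r}. of_nat (a i) * quadratic_ct ?T a r i t)) * multinomial S a"
      proof -
        have "CT (X r * (X t * X_pow r (- 2)) * dyson ?T a) = linear_ct ?T a r * multinomial S a"
          using one[of t] that remove.hyps by (simp add: mult.assoc)
        moreover have "(\<Sum>i\<in>?T - {r}. of_nat (a i) * CT (X i * (X t * X_pow r (- 2)) * dyson ?T a))
            = (\<Sum>i\<in>?T - {r}. of_nat (a i) * quadratic_ct ?T a r i t) * multinomial S a"
          unfolding sum_distrib_right
          using pair[of _ t] that remove.hyps by (intro sum.cong refl) (simp add: mult.assoc)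
        ultimately show ?thesis by (simp add: distrib_right mult.assoc)
      qed
      finally have "CT (X k * X t * X_pow r (- 2) * dyson S a) = - (of_nat (a r) * linear_ct ?T a r
           + (\<Sum>i\<in>?T - {r}. of_nat (a i) * quadratic_ct ?T a r i t)) * multinomial S a"
        by (simp only: mult.assoc mult_minus_left)
      also have "- (of_nat (a r) * linear_ct ?T a r
           + (\<Sum>i\<in>?T - {r}. of_nat (a i) * quadratic_ct ?T a r i t)) = quadratic_ct S a r k t"
        using that remove.hyps by (intro quadratic_boundary_distinct) auto
      finally show ?thesis .
    qed
    show ?case
    proof (intro impI)
      assume *: "r \<in> S" "s \<in> S - {r}" "t \<in> S - {r}"
      consider "k = r" | "k \<noteq> r" "k = s" "t = s" | "k \<noteq> r" "k = s" "t \<noteq> s"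
        | "k \<noteq> r" "k = t" "t \<noteq> s" | "k \<notin> {r, s, t}" by auto
      then show "CT (X s * X t * X_pow r (- 2) * dyson S a) = quadratic_ct S a r s t * multinomial S a"
      proof cases
        case 1
        then have "CT (X s * X t * X_pow r (- 2) * dyson S a) = 0"
          using remove.hyps * by (intro CT_dyson_negative_power[of S r] exps_in_mult[where E = "{0}" and F = "{- 2}"]
              exps_in_mult[where E = "{0}" and F = "{0}"] exps_in_X_pow) auto
        then show ?thesis using 1 remove.hyps by (simp add: quadratic_ct_def)
      next
        case 2
        let ?q = "\<lambda>i j. CT (X i * X j * X_pow r (- 2) * dyson ?T a)"
        have r: "finite ?T" "r \<in> ?T" using remove.hyps * 2 by auto
        have "2 * CT ((X k)\<^sup>2 * X_pow r (- 2) * dyson S a)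
            = (\<Sum>i\<in>?T. \<Sum>j\<in>?T. of_nat (a i) * of_nat (a j) * ?q i j) - (\<Sum>i\<in>?T. of_nat (a i) * ?q i i)"
          using 2 remove.hyps by (intro CT_dyson_remove exps_in_X_pow) auto
        also have "(\<Sum>i\<in>?T. \<Sum>j\<in>?T. of_nat (a i) * of_nat (a j) * ?q i j)
            = ((of_nat (a r))\<^sup>2 + 2 * of_nat (a r) * (\<Sum>i\<in>?T - {r}. of_nat (a i) * linear_ct ?T a r)
              + (\<Sum>i\<in>?T - {r}. \<Sum>j\<in>?T - {r}. of_nat (a i) * of_nat (a j) * quadratic_ct ?T a r i j))
              * multinomial S a"
        proof -
          have swap: "?q i r = ?q r i" for i by (simp only: mult.commute[of "X i"])
          have poly: "x * x * M + x * l * M + (x * l * M + d * M) = (x\<^sup>2 + 2 * x * l + d) * M"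
            for x l d M :: rat by (simp add: power2_eq_square algebra_simps)
          let ?U = "?T - {r}"
          have "(\<Sum>i\<in>?T. \<Sum>j\<in>?T. of_nat (a i) * of_nat (a j) * ?q i j)
              = of_nat (a r) * of_nat (a r) * ?q r r
                + (\<Sum>j\<in>?U. of_nat (a r) * of_nat (a j) * ?q r j)
                + ((\<Sum>i\<in>?U. of_nat (a i) * of_nat (a r) * ?q i r)
                + (\<Sum>i\<in>?U. \<Sum>j\<in>?U. of_nat (a i) * of_nat (a j) * ?q i j))"
            by (simp only: sum.remove[OF r] sum.distrib)
          also have "(\<Sum>j\<in>?U. of_nat (a r) * of_nat (a j) * ?q r j)
              = of_nat (a r) * (\<Sum>i\<in>?U. of_nat (a i) * linear_ct ?T a r) * multinomial S a"
            unfolding sum_distrib_left sum_distrib_right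
            by (intro sum.cong refl, subst one[OF r(2)]) (simp_all only: mult.assoc)
          also have "(\<Sum>i\<in>?U. of_nat (a i) * of_nat (a r) * ?q i r)
              = of_nat (a r) * (\<Sum>i\<in>?U. of_nat (a i) * linear_ct ?T a r) * multinomial S a"
            unfolding sum_distrib_left sum_distrib_right
            by (intro sum.cong refl, subst swap, subst one[OF r(2)]) (simp_all only: mult_ac)
          also have "(\<Sum>i\<in>?U. \<Sum>j\<in>?U. of_nat (a i) * of_nat (a j) * ?q i j)
              = (\<Sum>i\<in>?U. \<Sum>j\<in>?U. of_nat (a i) * of_nat (a j) * quadratic_ct ?T a r i j) * multinomial S a"
            unfolding sum_distrib_right
            by (intro sum.cong refl, subst pair[OF r(2)]) (simp_all only: mult.assoc)
          finally show ?thesis unfolding none by (simp only: poly)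
        qed
        also have "(\<Sum>i\<in>?T. of_nat (a i) * ?q i i) = (of_nat (a r)
              + (\<Sum>i\<in>?T - {r}. of_nat (a i) * quadratic_ct ?T a r i i)) * multinomial S a"
          unfolding sum.remove[OF r] none distrib_right sum_distrib_right
          by (intro arg_cong2[where f = plus] sum.cong refl, subst pair[OF r(2)])
            (simp_all only: mult.assoc)
        finally have "2 * CT ((X k)\<^sup>2 * X_pow r (- 2) * dyson S a)
            = ((of_nat (a r))\<^sup>2 + 2 * of_nat (a r) * (\<Sum>i\<in>?T - {r}. of_nat (a i) * linear_ct ?T a r)
             + (\<Sum>i\<in>?T - {r}. \<Sum>j\<in>?T - {r}. of_nat (a i) * of_nat (a j) * quadratic_ct ?T a r i j)
             - (of_nat (a r) + (\<Sum>i\<in>?T - {r}. of_nat (a i) * quadratic_ct ?T a r i i)))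
             * multinomial S a"
          by (simp only: left_diff_distrib)
        also have "(of_nat (a r))\<^sup>2 + 2 * of_nat (a r) * (\<Sum>i\<in>?T - {r}. of_nat (a i) * linear_ct ?T a r)
             + (\<Sum>i\<in>?T - {r}. \<Sum>j\<in>?T - {r}. of_nat (a i) * of_nat (a j) * quadratic_ct ?T a r i j)
             - (of_nat (a r) + (\<Sum>i\<in>?T - {r}. of_nat (a i) * quadratic_ct ?T a r i i))
             = 2 * quadratic_ct S a r k k"
          using 2 remove.hyps * by (intro quadratic_boundary_equal) auto
        finally have "CT ((X k)\<^sup>2 * X_pow r (- 2) * dyson S a) = quadratic_ct S a r k k * multinomial S a"
          by simp
        then show ?thesis using 2 by (simp add: power2_eq_square)
      next
        case 3
        then show ?thesis using distinct[of t] * by auto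
      next
        case 4
        then have "CT (X t * X s * X_pow r (- 2) * dyson S a) = quadratic_ct S a r t s * multinomial S a"
          using distinct[of s] * by auto
        then show ?thesis
          by (simp only: quadratic_ct_commute[of S a r t s] mult.commute[of "X t" "X s"])
      next
        case 5
        then have "CT (X s * X t * X_pow r (- 2) * dyson S a) = CT (X s * X t * X_pow r (- 2) * dyson ?T a)"
          using remove.hyps by (intro CT_dyson_remove exps_in_mult[where E = "{0}" and F = "{0}"] exps_in_X_pow) auto
        moreover have "pair_correction S a r s t = pair_correction ?T a r s t"
          using 5 remove.hyps * by (subst pair_correction_remove[of S k]) (auto simp: pair_correction_def)
        ultimately show ?thesis
          using 5 remove.hyps * pair[of s t] by (simp add: quadratic_ct_def rest_remove)
      qed
    qed
  next
    case (step S a)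
    show ?case
    proof (intro impI)
      assume *: "r \<in> S" "s \<in> S - {r}" "t \<in> S - {r}"
      show "CT (X s * X t * X_pow r (- 2) * dyson S a) = quadratic_ct S a r s t * multinomial S a"
      proof (rule CT_dyson_step[where f = "\<lambda>a. quadratic_ct S a r s t", OF step.hyps])
        show "CT (X s * X t * X_pow r (- 2) * dyson S (a(k := a k - 1))) =
            quadratic_ct S (a(k := a k - 1)) r s t * multinomial S (a(k := a k - 1))" if "k \<in> S" for k
          using step.IH[OF that] * by blast
        show "(\<Sum>k\<in>S. of_nat (a k) * quadratic_ct S (a(k := a k - 1)) r s t) =
            of_nat (sum a S) * quadratic_ct S a r s t"
          by (rule quadratic_step[OF step.hyps(1) *(1,2) step.hyps(3)])
      qed
    qed
  qed simp
  then show ?thesis using assms by simp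
qed

theorem proposition3p1:
  fixes n :: nat and a :: "nat \<Rightarrow> nat" and r s t u v :: nat
  assumes "{r, s, t, u, v} \<subseteq> {1..n}"
    and "distinct [r, s, t, u, v]"
  shows "CT ((X s - X t) * (X u - X v) * X_pow r (- 2) * dyson_product n a) = 0 \<and>
         CT ((X s - X u) * (X s - X v) * X_pow r (- 2) * dyson_product n a) =
           - (of_nat (a r) * (of_nat (a_sum n a) + 1)
              / ((2 + a_sum_without n a r) * (1 + a_sum_without n a r - of_nat (a s))))
           * dyson_const n a \<and>
         CT ((X s - X t)\<^sup>2 * X_pow r (- 2) * dyson_product n a) =
           - (of_nat (a r) * (of_nat (a_sum n a) + 1) / (2 + a_sum_without n a r))
           * (1 / (1 + a_sum_without n a r - of_nat (a s))
              + 1 / (1 + a_sum_without n a r - of_nat (a t)))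
           * dyson_const n a"
proof -
  define S where "S = {1..n}"
  define A m H h where "A = (of_nat (a r) :: rat)" and "m = rest S a r"
    and "H = (\<Sum>i\<in>S - {r}. ratio S a r i)" and "h = ratio S a r"
  define C where "C = multinomial S a"
  define K where "K = A / ((1 + m) * (2 + m))"
  have S: "finite S" "r \<in> S" "s \<in> S - {r}" "t \<in> S - {r}" "u \<in> S - {r}" "v \<in> S - {r}"
    using assms by (auto simp: S_def)
  have neq: "s \<noteq> t" "s \<noteq> u" "s \<noteq> v" "t \<noteq> u" "t \<noteq> v" "u \<noteq> v" using assms(2) by auto
  have m: "1 + m > 0" "2 + m > 0" using rest_nonneg[of S a r] by (simp_all add: m_def)
  have total: "of_nat (a_sum n a) = A + m" and without: "a_sum_without n a r = m"
    using of_nat_sum_eq[OF S(1,2), of a]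
    by (simp_all add: a_sum_without_def a_sum_def A_def m_def S_def del: of_nat_sum)
  have const: "dyson_const n a = C"
    by (simp add: dyson_const_def a_sum_def C_def multinomial_def S_def)
  have D: "dyson_product n a = dyson S a" by (simp add: S_def dyson_product_eq)
  define Q where "Q i j = CT (X i * X j * X_pow r (- 2) * dyson_product n a)" for i j
  have Q: "Q i j = K * (2 * A + m + (1 + A + m) * (h i + h j - H - of_bool (i = j) * (1 + h i))) * C"
    if "i \<in> S - {r}" "j \<in> S - {r}" for i j
    using CT_dyson_quadratic[OF S(1,2) that, of a]
    by (simp only: Q_def D quadratic_ct_def pair_correction_expand[OF S(1) that]
        A_def m_def H_def h_def K_def C_def)
  have expand: "CT ((X i - X j) * (X k - X l) * X_pow r (- 2) * dyson_product n a)
      = Q i k - Q i l - Q j k + Q j l" for i j k l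
    unfolding Q_def CT_add[symmetric] CT_diff[symmetric]
    by (intro arg_cong[where f = CT]) (simp add: algebra_simps)
  \<comment> \<open>The common building block of the two nonzero values.\<close>
  have h: "K * (1 + A + m) * (1 + h i) = A * (A + m + 1) / (2 + m) * (1 / (1 + m - of_nat (a i)))"
    if "i \<in> S - {r}" for i
    using m one_plus_ratio[OF S(1) that, of a]
    by (simp add: K_def h_def m_def[symmetric] add_ac)
  \<comment> \<open>All four pairs are distinct, so the additively separated terms cancel.\<close>
  have "CT ((X s - X t) * (X u - X v) * X_pow r (- 2) * dyson_product n a) = 0"
    unfolding expand using neq S by (simp add: Q algebra_simps)
  \<comment> \<open>Only the diagonal pair \<open>(s, s)\<close> leaves a contribution.\<close>
  moreover have "CT ((X s - X u) * (X s - X v) * X_pow r (- 2) * dyson_product n a)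
      = - (K * (1 + A + m) * (1 + h s)) * C"
    unfolding expand using neq S by (simp add: Q algebra_simps)
  \<comment> \<open>The two diagonal pairs contribute, one for each variable.\<close>
  moreover have "CT ((X s - X t)\<^sup>2 * X_pow r (- 2) * dyson_product n a)
      = - (K * (1 + A + m) * (1 + h s) + K * (1 + A + m) * (1 + h t)) * C"
    unfolding power2_eq_square expand using neq S by (simp add: Q algebra_simps)
  ultimately show ?thesis
    unfolding h[OF S(3)] h[OF S(4)] total without const
    by (simp add: A_def distrib_left)
qed

end
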